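(* Let $p$ be a prime and let $f\in\mathbb{C}[X]$ be a non-trivial CA-polynomial of degree $N=p+1$. Let $c$ be the center of mass of $f$. Then there are at least two indices $2\le l_1<l_2\le N-2$ such that $f^{(l_1)}(c)=f^{(l_2)}(c)=0$.
   Context: A polynomial $f\in\mathbb{C}[X]$ of degree $N\ge 1$ is called a CA-polynomial if for each $i=1,\dots,N-1$ the polynomials $f$ and $f^{(i)}$ (the $i$-th derivative) have a common complex root. A polynomial is called non-trivial if it has at least two distinct roots in $\mathbb{C}$. The center of mass of $f$ is $\frac1N\sum_{j=1}^N z_j$, where $z_1,\dots,z_N$ are the roots of $f$ counted with multiplicity; equivalently, it is the unique root of $f^{(N-1)}$. *)

theory Defs
  imports "HOL-Computational_Algebra.Computational_Algebra"
begin

definition CA_polynomial :: "complex poly \<Rightarrow> bool" where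
  "CA_polynomial f \<longleftrightarrow> degree f \<ge> 1 \<and>
     (\<forall>i\<in>{1..degree f - 1}. \<exists>z. poly f z = 0 \<and> poly ((pderiv ^^ i) f) z = 0)"

definition nontrivial_poly :: "complex poly \<Rightarrow> bool" where
  "nontrivial_poly f \<longleftrightarrow> (\<exists>z w. z \<noteq> w \<and> poly f z = 0 \<and> poly f w = 0)"

(* The multiset proots f has size degree f for nonzero complex f (size_proots_complex),
   so dividing by the degree gives the mean of the roots. *)
definition center_of_mass :: "complex poly \<Rightarrow> complex" where
  "center_of_mass f = (\<Sum>z\<in>#proots f. z) / of_nat (degree f)"

end

theory Submission
  imports Defs
begin

text \<open>Choose a valuation ring \<open>V\<close> of \<open>\<complex>\<close> in which \<open>p\<close> is not invertible, and normalise so that \<open>c = 0\<close>,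
  all roots lie in \<open>V\<close> and \<open>1\<close> is a root.  As \<open>p\<close> divides \<open>binomial (p+1) i\<close> for \<open>2 \<le> i < p\<close>, the
  common roots show, for \<open>i = p-1, \<dots>, 2\<close>, that the coefficient \<open>a i\<close> equals \<open>p * \<alpha> i\<close> with
  \<open>\<alpha> i \<in> V\<close>.  So the polynomial reduces to \<open>X (X - 1)^p\<close>, and every nonzero root is congruent to \<open>1\<close>.
  If \<open>a i \<noteq> 0\<close>, the common root with the \<open>i\<close>-th derivative is such a root; dividing by \<open>p\<close> gives
  \<open>(\<Sum>j. binomial j i * \<alpha> j) + binomial (p+1) i / p \<equiv> 0\<close>.  If this holds for all \<open>i\<close> but one, \<open>l\<close>,
  the combination with weights \<open>(-1)^i * (1 - binomial i l)\<close> eliminates the \<open>\<alpha> j\<close> as well as the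
  missing equation, and leaves an integer that should be divisible by \<open>p\<close> but is not.  When no \<open>a i\<close>
  vanishes one takes \<open>l = p\<close>.\<close>

section \<open>Valuation rings\<close>

definition subring_of_field :: "'a::field set \<Rightarrow> bool" where
  "subring_of_field V \<longleftrightarrow> 1 \<in> V \<and> (\<forall>x\<in>V. \<forall>y\<in>V. x - y \<in> V \<and> x * y \<in> V)"

definition valuation_ring :: "'a::field set \<Rightarrow> bool" where
  "valuation_ring V \<longleftrightarrow> subring_of_field V \<and> (\<forall>x. x \<in> V \<or> inverse x \<in> V)"

lemma subring_of_field_Union_chain:
  assumes "\<C> \<noteq> {}" "\<And>V. V \<in> \<C> \<Longrightarrow> subring_of_field V"
    and "\<And>V W. V \<in> \<C> \<Longrightarrow> W \<in> \<C> \<Longrightarrow> V \<subseteq> W \<or> W \<subseteq> V"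
  shows "subring_of_field (\<Union>\<C>)"
  unfolding subring_of_field_def
proof (intro conjI ballI)
  show "1 \<in> \<Union>\<C>"
    using assms(1,2) unfolding subring_of_field_def by blast
next
  fix x y assume "x \<in> \<Union>\<C>" "y \<in> \<Union>\<C>"
  then obtain V where "V \<in> \<C>" "x \<in> V" "y \<in> V"
    using assms(3) by blast
  then show "x - y \<in> \<Union>\<C>" "x * y \<in> \<Union>\<C>"
    using assms(2) unfolding subring_of_field_def by blast+
qed

locale field_subring =
  fixes V :: "'a::field set"
  assumes subring: "subring_of_field V"
begin

lemma one_mem [simp]: "1 \<in> V"
  and diff_mem: "x \<in> V \<Longrightarrow> y \<in> V \<Longrightarrow> x - y \<in> V"
  and mult_mem: "x \<in> V \<Longrightarrow> y \<in> V \<Longrightarrow> x * y \<in> V"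
  using subring unfolding subring_of_field_def by auto

lemma zero_mem [simp]: "0 \<in> V"
  using diff_mem[of 1 1] by simp

lemma uminus_mem: "x \<in> V \<Longrightarrow> - x \<in> V"
  using diff_mem[of 0 x] by simp

lemma add_mem: "x \<in> V \<Longrightarrow> y \<in> V \<Longrightarrow> x + y \<in> V"
  using diff_mem[of x "- y"] uminus_mem by simp

lemma power_mem: "x \<in> V \<Longrightarrow> x ^ n \<in> V"
  by (induction n) (auto intro: mult_mem)

lemma sum_mem: "(\<And>i. i \<in> I \<Longrightarrow> f i \<in> V) \<Longrightarrow> (\<Sum>i\<in>I. f i) \<in> V"
  by (induction I rule: infinite_finite_induct) (auto intro: add_mem)

lemma of_nat_mem [simp]: "of_nat n \<in> V"
  by (induction n) (auto intro: add_mem)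

lemma of_int_mem [simp]: "of_int n \<in> V"
  by (cases n rule: int_cases2) (auto intro: uminus_mem)

section \<open>Polynomials over \<open>V\<close> and simple ring extensions\<close>

definition poly_over :: "'a poly \<Rightarrow> bool" where
  "poly_over q \<longleftrightarrow> (\<forall>i. coeff q i \<in> V)"

lemma poly_over_diff: "poly_over q \<Longrightarrow> poly_over r \<Longrightarrow> poly_over (q - r)"
  and poly_over_mult: "poly_over q \<Longrightarrow> poly_over r \<Longrightarrow> poly_over (q * r)"
  and poly_over_add: "poly_over q \<Longrightarrow> poly_over r \<Longrightarrow> poly_over (q + r)"
  and poly_over_smult: "a \<in> V \<Longrightarrow> poly_over q \<Longrightarrow> poly_over (smult a q)"
  and poly_over_monom: "a \<in> V \<Longrightarrow> poly_over (monom a n)"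
  and poly_over_reflect: "poly_over q \<Longrightarrow> poly_over (reflect_poly q)"
  unfolding poly_over_def
  by (auto simp: coeff_mult coeff_reflect_poly intro!: diff_mem mult_mem sum_mem add_mem)

lemma poly_over_pCons: "poly_over (pCons a q) \<longleftrightarrow> a \<in> V \<and> poly_over q"
  unfolding poly_over_def by (auto simp: coeff_pCons split: nat.splits)

text \<open>This is the ring \<open>V[x]\<close> generated by \<open>x\<close> over \<open>V\<close>
  inside the field.\<close>

definition adjoin :: "'a \<Rightarrow> 'a set" where
  "adjoin x = {poly q x | q. poly_over q}"

lemma subring_adjoin: "subring_of_field (adjoin x)"
  unfolding subring_of_field_def adjoin_def
proof (intro conjI ballI)
  have "poly_over 1"
    using poly_over_monom[of 1 0] by simp
  then show "1 \<in> {poly q x |q. poly_over q}"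
    by (auto intro!: exI[of _ 1])
next
  fix y z assume "y \<in> {poly q x |q. poly_over q}" "z \<in> {poly q x |q. poly_over q}"
  then obtain q r where "poly_over q" "poly_over r" "y = poly q x" "z = poly r x"
    by blast
  then show "y - z \<in> {poly q x |q. poly_over q}"
    by (auto intro!: exI[of _ "q - r"] poly_over_diff)
  show "y * z \<in> {poly q x |q. poly_over q}"
    using \<open>poly_over q\<close> \<open>poly_over r\<close> \<open>y = _\<close> \<open>z = _\<close>
    by (auto intro!: exI[of _ "q * r"] poly_over_mult)
qed

lemma subset_adjoin: "V \<subseteq> adjoin x"
proof
  fix a assume "a \<in> V"
  then show "a \<in> adjoin x"
    unfolding adjoin_def using poly_over_monom[of a 0]
    by (auto simp: monom_0 intro!: exI[of _ "[:a:]"])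
qed

lemma self_mem_adjoin: "x \<in> adjoin x"
  unfolding adjoin_def using poly_over_monom[of 1 1]
  by (auto simp: poly_monom intro!: exI[of _ "monom 1 1"])

text \<open>The relation for \<^term>\<open>inverse x\<close> makes \<open>x ^ n\<close> a combination of lower powers, which removes
  the leading term of the relation for \<^term>\<open>x\<close>.\<close>

lemma lower_degree_relation:
  assumes u: "u \<in> V" and unit: "\<And>b. b \<in> V \<Longrightarrow> inverse (1 - u * b) \<in> V \<and> u * b \<noteq> 1"
    and x: "x \<noteq> 0"
    and q: "poly_over q" "u * poly q x = 1"
    and r: "poly_over r" "u * poly r (inverse x) = 1"
    and deg: "degree r \<le> degree q"
  shows "\<exists>q'. poly_over q' \<and> u * poly q' x = 1 \<and> degree q' < degree q"
proof -
  obtain b r' where r_eq: "r = pCons b r'"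
    by (cases r) auto
  have b: "b \<in> V" and r': "poly_over r'"
    using r r_eq by (auto simp: poly_over_pCons)
  \<comment> \<open>A constant \<open>r = [:b:]\<close> would give \<open>u * b = 1\<close>, which
    \<open>unit\<close> excludes.\<close>
  have "r' \<noteq> 0"
    using unit[OF b] r(2) r_eq by auto
  then have deg': "degree r' < degree q"
    using deg r_eq by simp
  define n where "n = degree q"
  define w where "w = inverse (1 - u * b)"
  have w: "w \<in> V" "w * (1 - u * b) = 1"
    using unit[OF b] unfolding w_def by auto
  \<comment> \<open>Reversing \<open>r'\<close> and padding gives
    \<open>poly T x = x ^ (n - 1) * poly r' (inverse x)\<close>, so the powers of
    \<open>inverse x\<close> become powers of \<open>x\<close> with exponents below
    \<open>n\<close>.\<close>
  define T where "T = reflect_poly r' * monom 1 (n - 1 - degree r')"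
  have T_over: "poly_over T"
    unfolding T_def by (intro poly_over_mult poly_over_reflect r' poly_over_monom) simp
  have "degree T \<le> degree r' + (n - 1 - degree r')"
    unfolding T_def
    by (rule order.trans[OF degree_mult_le]) (auto intro!: add_mono degree_reflect_poly_le degree_monom_le)
  then have T_deg: "degree T < n"
    using deg' unfolding n_def by linarith
  have "poly (reflect_poly r') x = x ^ degree r' * poly r' (inverse x)"
    using x by (simp add: poly_reflect_poly_nz)
  then have "poly T x = x ^ (degree r' + (n - 1 - degree r')) * poly r' (inverse x)"
    unfolding T_def by (simp add: poly_monom power_add)
  moreover have "degree r' + (n - 1 - degree r') = n - 1"
    using deg' n_def by simp
  ultimately have "x * poly T x = x ^ Suc (n - 1) * poly r' (inverse x)"
    by simp
  then have "poly T x = x ^ n * (inverse x * poly r' (inverse x))"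
    using x deg' n_def by (simp add: field_simps)
  moreover have "u * (inverse x * poly r' (inverse x)) = 1 - u * b"
    using r(2) r_eq by (simp add: algebra_simps)
  ultimately have T_val: "u * poly T x = x ^ n * (1 - u * b)"
    by (metis mult.left_commute)
  define a where "a = lead_coeff q"
  have a: "a \<in> V"
    using q unfolding a_def poly_over_def by blast
  define q0 where "q0 = q - monom a n"
  \<comment> \<open>Since \<open>u * poly T x = x ^ n * (1 - u * b)\<close> and \<open>w\<close>
    inverts the last factor, the added term restores exactly the \<open>u * a * x ^ n\<close> lost
    with the leading monomial.\<close>
  define q' where "q' = q0 + smult (a * u * w) T"
  have "coeff q0 i = 0" if "i \<ge> n" for i
    using that unfolding q0_def a_def n_def by (cases "i = n") (auto simp: coeff_eq_0 n_def)
  then have q0_deg: "degree q0 < n"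
    using deg' by (metis degree_less_if_less_eqI less_nat_zero_code n_def not_gr_zero
        leading_coeff_0_iff not_less degree_0 leI)
  have "degree q' < n"
    unfolding q'_def
    by (rule degree_add_less[OF q0_deg]) (use T_deg degree_smult_le le_less_trans in blast)
  moreover have "poly_over q'"
    unfolding q'_def q0_def using a w u q T_over
    by (intro poly_over_add poly_over_diff poly_over_monom poly_over_smult mult_mem)
  moreover have "u * poly q' x = 1"
  proof -
    have "u * poly q' x = u * poly q x - u * a * x ^ n + u * a * w * (u * poly T x)"
      unfolding q'_def q0_def by (simp add: poly_monom algebra_simps)
    also have "\<dots> = 1 - u * a * x ^ n + u * a * x ^ n * (w * (1 - u * b))"
      unfolding T_val q(2) by (simp add: algebra_simps)
    finally show ?thesis
      using w by simp
  qed
  ultimately show ?thesis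
    unfolding n_def by blast
qed

text \<open>By maximality, adjoining any \<open>x\<close> outside \<open>V\<close> produces
  \<open>inverse u\<close>, hence a relation \<open>u * poly q x = 1\<close>. If both
  \<open>x\<close> and \<open>inverse x\<close> were outside, then among their relations of least
  degree the one of larger degree could still be lowered by
  \<open>lower_degree_relation\<close>.\<close>

lemma maximal_imp_valuation_ring:
  assumes u: "u \<in> V" "inverse u \<notin> V"
    and max: "\<And>W. subring_of_field W \<Longrightarrow> V \<subseteq> W \<Longrightarrow> inverse u \<notin> W \<Longrightarrow> W = V"
  shows "valuation_ring V"
proof -
  have u0: "u \<noteq> 0"
    using u by auto
  have relation: "\<exists>q. poly_over q \<and> u * poly q x = 1" if "x \<notin> V" for x
  proof -
    have "adjoin x \<noteq> V"
      using self_mem_adjoin that by blast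
    then have "inverse u \<in> adjoin x"
      using max[OF subring_adjoin subset_adjoin] by blast
    then obtain q where "poly_over q" "inverse u = poly q x"
      unfolding adjoin_def by blast
    then show ?thesis
      using u0 by (auto intro!: exI[of _ q] simp flip: \<open>inverse u = poly q x\<close>)
  qed
  have unit: "inverse (1 - u * b) \<in> V \<and> u * b \<noteq> 1" if b: "b \<in> V" for b
  proof -
    have ub: "u * b \<noteq> 1"
      using u b inverse_unique[of u b] by auto
    define d where "d = 1 - u * b"
    have d: "d \<in> V" "d \<noteq> 0"
      using u b ub unfolding d_def by (auto intro: diff_mem mult_mem)
    \<comment> \<open>All powers of \<open>d\<close> are congruent to \<open>1\<close> modulo
      \<open>u\<close>.\<close>
    have pow: "\<exists>t\<in>V. d ^ k = 1 - u * t" for k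
    proof (induction k)
      case 0
      show ?case by (auto intro!: bexI[of _ 0])
    next
      case (Suc k)
      then obtain t where t: "t \<in> V" "d ^ k = 1 - u * t" by blast
      have "d ^ Suc k = 1 - u * (b + t - u * b * t)"
        unfolding power_Suc t(2) unfolding d_def by (simp add: algebra_simps)
      moreover have "b + t - u * b * t \<in> V"
        using b u t by (intro add_mem diff_mem mult_mem)
      ultimately show ?case by blast
    qed
    \<comment> \<open>Otherwise multiplication by \<open>d ^ degree q\<close> clears the
      denominators; as this power is \<open>1 - u * t\<close>, the result
      \<open>inverse u - t\<close> lies in \<open>V\<close>, and so does
      \<open>inverse u\<close>.\<close>
    have "inverse u \<notin> adjoin (inverse d)"
    proof
      assume "inverse u \<in> adjoin (inverse d)"
      then obtain q where q: "poly_over q" "inverse u = poly q (inverse d)"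
        unfolding adjoin_def by blast
      define s where "s = poly (reflect_poly q) d"
      have s: "s \<in> V"
        using poly_over_reflect[OF q(1)] d unfolding s_def poly_altdef poly_over_def
        by (auto intro!: sum_mem mult_mem power_mem)
      have "s = d ^ degree q * inverse u"
        using d q unfolding s_def by (simp add: poly_reflect_poly_nz)
      moreover obtain t where "t \<in> V" "d ^ degree q = 1 - u * t"
        using pow by blast
      ultimately have "s = inverse u - t"
        using u0 by (simp add: field_simps)
      then have "inverse u = s + t" by simp
      then show False
        using u s \<open>t \<in> V\<close> by (auto intro: add_mem)
    qed
    then have "adjoin (inverse d) = V"
      using max[OF subring_adjoin subset_adjoin] by blast
    then show ?thesis
      using self_mem_adjoin[of "inverse d"] ub unfolding d_def by auto
  qed
  have "x \<in> V \<or> inverse x \<in> V" for x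
  proof (rule ccontr)
    assume neg: "\<not> (x \<in> V \<or> inverse x \<in> V)"
    then have x: "x \<noteq> 0" "inverse x \<noteq> 0"
      by auto
    define R where "R y q \<longleftrightarrow> poly_over q \<and> u * poly q y = 1" for y q
    define q where "q = arg_min degree (R x)"
    define r where "r = arg_min degree (R (inverse x))"
    obtain q0 r0 where "R x q0" "R (inverse x) r0"
      using relation neg unfolding R_def by blast
    then have q: "R x q" "\<And>q'. R x q' \<Longrightarrow> degree q \<le> degree q'"
      and r: "R (inverse x) r" "\<And>r'. R (inverse x) r' \<Longrightarrow> degree r \<le> degree r'"
      unfolding q_def r_def
      by (blast intro: arg_min_natI arg_min_nat_le)+
    show False
    proof (cases "degree r \<le> degree q")
      case True
      then show False
        using lower_degree_relation[OF u(1) unit x(1), of q r] q r unfolding R_def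
        by (meson not_less)
    next
      case False
      then show False
        using lower_degree_relation[OF u(1) unit x(2), of r q] q r unfolding R_def
        by (metis inverse_inverse_eq nat_le_linear not_less)
    qed
  qed
  then show ?thesis
    unfolding valuation_ring_def using subring by blast
qed

end

text \<open>Zorn's lemma gives a maximal subring among those that contain \<open>R\<close> and miss
  \<open>inverse u\<close>.\<close>

theorem valuation_ring_exists:
  fixes R :: "'a::field set"
  assumes "subring_of_field R" "u \<in> R" "inverse u \<notin> R"
  shows "\<exists>V. valuation_ring V \<and> R \<subseteq> V \<and> inverse u \<notin> V"
proof -
  define \<A> where "\<A> = {V. subring_of_field V \<and> R \<subseteq> V \<and> inverse u \<notin> V}"
  have "\<exists>V\<in>\<A>. \<forall>X\<in>\<A>. V \<subseteq> X \<longrightarrow> X = V"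
  proof (rule subset_Zorn_nonempty)
    show "\<A> \<noteq> {}"
      using assms unfolding \<A>_def by blast
  next
    fix \<C> assume C: "\<C> \<noteq> {}" "subset.chain \<A> \<C>"
    then have sub: "\<C> \<subseteq> \<A>"
      by (simp add: subset_chain_def)
    have "subring_of_field (\<Union>\<C>)"
      using C sub by (intro subring_of_field_Union_chain) (auto simp: subset_chain_def \<A>_def)
    then show "\<Union>\<C> \<in> \<A>"
      using C sub unfolding \<A>_def by blast
  qed
  then obtain V where V: "V \<in> \<A>" "\<And>X. X \<in> \<A> \<Longrightarrow> V \<subseteq> X \<Longrightarrow> X = V"
    by blast
  interpret field_subring V
    using V unfolding \<A>_def by unfold_locales blast
  have "valuation_ring V"
    by (rule maximal_imp_valuation_ring[of u]) (use V assms in \<open>auto simp: \<A>_def\<close>)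
  then show ?thesis
    using V unfolding \<A>_def by blast
qed

section \<open>Alternating sums of binomial coefficients\<close>

text \<open>The weights vanish at \<open>i = l\<close> and annihilate every row of Pascal's triangle
  except rows \<open>0\<close> and \<open>l\<close>.\<close>

definition wt :: "nat \<Rightarrow> nat \<Rightarrow> int" where
  "wt l i = (-1) ^ i * (1 - int (i choose l))"

text \<open>The product of binomials equals \<open>(n choose l) * ((n - l) choose (i - l))\<close>,
  which leaves the alternating sum of row \<open>n - l\<close>; it vanishes when
  \<open>n > l\<close>.\<close>

lemma sum_alternating_choose_choose:
  assumes "n \<noteq> l"
  shows "(\<Sum>i\<le>n. (-1) ^ i * int (n choose i) * int (i choose l)) = 0"
proof (cases "n < l")
  case True
  then show ?thesis by (auto intro!: sum.neutral simp: binomial_eq_0)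
next
  case False
  then have n: "n > l" using assms by simp
  have "(\<Sum>i\<le>n. (-1) ^ i * int (n choose i) * int (i choose l))
      = (\<Sum>i\<in>{l..n}. (-1) ^ i * int (n choose i) * int (i choose l))"
    by (rule sum.mono_neutral_right) (auto simp: binomial_eq_0)
  also have "\<dots> = (\<Sum>i\<in>{l..n}. (-1) ^ i * int (n choose l) * int ((n - l) choose (i - l)))"
    by (rule sum.cong) (auto simp: choose_mult mult.assoc simp flip: of_nat_mult)
  also have "\<dots> = (\<Sum>k\<le>n - l. (-1) ^ (k + l) * int (n choose l) * int ((n - l) choose k))"
    by (rule sum.reindex_bij_witness[of _ "\<lambda>k. k + l" "\<lambda>i. i - l"]) (use n in auto)
  also have "\<dots> = (-1) ^ l * int (n choose l) * (\<Sum>k\<le>n - l. (-1) ^ k * int ((n - l) choose k))"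
    by (simp add: sum_distrib_left power_add mult_ac)
  finally show ?thesis
    using n choose_alternating_sum[of "n - l", where 'a = int] by simp
qed

lemma sum_wt_choose:
  assumes "n \<noteq> 0" "n \<noteq> l" "n \<le> m"
  shows "(\<Sum>i\<le>m. wt l i * int (n choose i)) = 0"
proof -
  have "(\<Sum>i\<le>m. wt l i * int (n choose i)) = (\<Sum>i\<le>n. wt l i * int (n choose i))"
    by (rule sum.mono_neutral_right) (use assms in \<open>auto simp: binomial_eq_0\<close>)
  also have "\<dots> = (\<Sum>i\<le>n. (-1) ^ i * int (n choose i))
      - (\<Sum>i\<le>n. (-1) ^ i * int (n choose i) * int (i choose l))"
    unfolding wt_def by (simp add: algebra_simps flip: sum_subtractf)
  finally show ?thesis
    using assms choose_alternating_sum[of n, where 'a = int]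
    by (simp add: sum_alternating_choose_choose)
qed

lemma atMost_prime_succ_split:
  fixes p :: nat
  assumes "p \<ge> 2"
  shows "{..p + 1} = {0, 1, p, p + 1} \<union> {2..p - 1}"
  using assms by auto

lemma sum_atMost_prime_succ:
  fixes p :: nat and F :: "nat \<Rightarrow> 'a::comm_monoid_add"
  assumes "p \<ge> 2"
  shows "(\<Sum>i\<le>p + 1. F i) = F 0 + F 1 + (\<Sum>i=2..p-1. F i) + F p + F (p + 1)"
proof -
  have "(\<Sum>i\<le>p + 1. F i) = (\<Sum>i\<in>{0, 1, p, p + 1}. F i) + (\<Sum>i=2..p-1. F i)"
    unfolding atMost_prime_succ_split[OF assms]
    by (rule sum.union_disjoint) (use assms in auto)
  then show ?thesis
    using assms by (simp add: add_ac)
qed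

text \<open>Neighbouring entries of row \<open>p - 1\<close> add up to an entry of row
  \<open>p\<close> divisible by \<open>p\<close>, so modulo \<open>p\<close> they alternate in sign
  starting from \<open>1\<close>.\<close>

lemma choose_pred_prime_cong:
  fixes p k :: nat
  assumes "prime p" "k < p"
  shows "int p dvd int ((p - 1) choose k) - (-1) ^ k"
  using assms(2)
proof (induction k)
  case 0
  show ?case by simp
next
  case (Suc k)
  have IH: "int p dvd int ((p - 1) choose k) - (-1) ^ k"
    by (rule Suc.IH) (use Suc.prems in simp)
  have "p dvd p choose Suc k"
    by (rule dvd_choose_prime) (use assms Suc.prems in auto)
  moreover have "int (p choose Suc k) = int ((p - 1) choose k) + int ((p - 1) choose Suc k)"
    using Suc.prems by (cases p) auto
  ultimately have "int p dvd int ((p - 1) choose k) + int ((p - 1) choose Suc k)"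
    by (metis int_dvd_int_iff)
  then have "int p dvd (int ((p - 1) choose k) + int ((p - 1) choose Suc k)) - (int ((p - 1) choose k) - (-1) ^ k)"
    by (rule dvd_diff[OF _ IH])
  then show ?case by simp
qed

text \<open>Row \<open>p + 1\<close> is annihilated by the weights. Its four outer terms therefore
  determine \<open>p * D\<close>, where \<open>D\<close> is the integer in question, and
  \<open>(l - 1) * D\<close> can then be computed modulo \<open>p\<close>.\<close>

lemma wt_combination_not_dvd:
  fixes p l :: nat and c :: "nat \<Rightarrow> nat"
  assumes p: "prime p" and l: "2 \<le> l" "l \<le> p"
    and c: "\<And>i. i \<in> {2..p-1} \<Longrightarrow> (p + 1) choose i = p * c i"
  shows "\<not> int p dvd 1 - (\<Sum>i=2..p-1. wt l i * int (c i))"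
proof
  define D where "D = 1 - (\<Sum>i=2..p-1. wt l i * int (c i))"
  assume "int p dvd 1 - (\<Sum>i=2..p-1. wt l i * int (c i))"
  then have dvd: "int p dvd D" unfolding D_def .
  have p2: "p \<ge> 2" using p prime_ge_2_nat by blast
  show False
  proof (cases "p = 2")
    \<comment> \<open>The range \<open>{2..p-1}\<close> is empty here, so
      \<open>D = 1\<close>.\<close>
    case True
    then show False using dvd unfolding D_def by simp
  next
    case False
    then have odd: "odd p"
      using p p2 prime_odd_nat by auto
    have "(\<Sum>i\<le>p + 1. wt l i * int ((p + 1) choose i)) = 0"
      by (rule sum_wt_choose) (use l in auto)
    then have "0 = wt l 0 + wt l 1 * (p + 1) + (\<Sum>i=2..p-1. wt l i * int ((p + 1) choose i))
        + wt l p * (p + 1) + wt l (p + 1)"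
      unfolding sum_atMost_prime_succ[OF p2] by simp
    also have "(\<Sum>i=2..p-1. wt l i * int ((p + 1) choose i)) = p * (\<Sum>i=2..p-1. wt l i * int (c i))"
      unfolding sum_distrib_left
    proof (rule sum.cong[OF refl])
      fix i assume "i \<in> {2..p-1}"
      then show "wt l i * int ((p + 1) choose i) = p * (wt l i * int (c i))"
        unfolding c[OF \<open>i \<in> {2..p-1}\<close>] by simp
    qed
    also have "(\<Sum>i=2..p-1. wt l i * int (c i)) = 1 - D"
      unfolding D_def by simp
    finally have "p * D = p + wt l 0 + wt l 1 * (p + 1) + wt l p * (p + 1) + wt l (p + 1)"
      by (simp add: algebra_simps)
    also have "\<dots> = - p + p * int (p choose l) - int (p choose (l - 1))"
    proof -
      have "(p + 1) choose l = (p choose l) + (p choose (l - 1))"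
        using l by (cases l) auto
      then show ?thesis
        using l odd by (simp add: wt_def algebra_simps binomial_eq_0)
    qed
    finally have pD: "p * D = - p + p * int (p choose l) - int (p choose (l - 1))" .
    \<comment> \<open>Multiplying by \<open>l - 1\<close> exposes a factor \<open>p\<close> in the
      last binomial coefficient, so that \<open>p\<close> can be cancelled.\<close>
    have "(l - 1) * (p choose (l - 1)) = p * ((p - 1) choose (l - 2))"
      using times_binomial_minus1_eq[of "l - 1" p] l by (simp add: numeral_2_eq_2)
    then have absorb: "int (l - 1) * int (p choose (l - 1)) = p * int ((p - 1) choose (l - 2))"
      by (metis of_nat_mult)
    have "p * (int (l - 1) * D) = int (l - 1) * (p * D)"
      by simp
    also have "\<dots> = p * (int (l - 1) * (int (p choose l) - 1)) - int (l - 1) * int (p choose (l - 1))"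
      unfolding pD by (simp add: algebra_simps)
    also have "\<dots> = p * (int (l - 1) * (int (p choose l) - 1) - int ((p - 1) choose (l - 2)))"
      unfolding absorb by (simp add: algebra_simps)
    finally have "int (l - 1) * D = int (l - 1) * (int (p choose l) - 1) - int ((p - 1) choose (l - 2))"
      using p2 by simp
    moreover have "int p dvd int (l - 1) * D"
      using dvd by simp
    ultimately have "int p dvd int (l - 1) * (int (p choose l) - 1) - int ((p - 1) choose (l - 2))"
      by simp
    moreover have "int p dvd int ((p - 1) choose (l - 2)) - (-1) ^ (l - 2)"
      by (rule choose_pred_prime_cong) (use p p2 l in auto)
    ultimately have "int p dvd (int (l - 1) * (int (p choose l) - 1) - int ((p - 1) choose (l - 2)))
        + (int ((p - 1) choose (l - 2)) - (-1) ^ (l - 2))"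
      by (rule dvd_add)
    then have main: "int p dvd int (l - 1) * (int (p choose l) - 1) - (-1) ^ (l - 2)"
      by (simp only: diff_add_cancel add_diff_eq)
    show False
    proof (cases "l = p")
      case True
      then have "int p dvd 1"
        using main by (auto simp: minus_one_power_iff split: if_splits)
      then show False using p2 by simp
    next
      case False
      then have "p dvd p choose l"
        using l p by (intro dvd_choose_prime) auto
      then have "int p dvd int (l - 1) * int (p choose l)"
        by simp
      then have "int p dvd int (l - 1) * int (p choose l)
          - (int (l - 1) * (int (p choose l) - 1) - (-1) ^ (l - 2))"
        using main by (rule dvd_diff)
      then have "int p dvd int (l - 1) + (-1) ^ (l - 2)"
        by (simp add: algebra_simps)
      \<comment> \<open>The value is \<open>l\<close> for even \<open>l\<close> and
        \<open>l - 2\<close> for odd \<open>l\<close>; oddness matters at the lower bound, where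
        \<open>l\<close> is then at least \<open>3\<close>.\<close>
      moreover have "0 < int (l - 1) + (-1) ^ (l - 2)" "int (l - 1) + (-1) ^ (l - 2) < int p"
        using l False by (cases "even l"; simp add: of_nat_diff; presburger)+
      ultimately show False
        using zdvd_imp_le by fastforce
    qed
  qed
qed

section \<open>Reduction modulo the maximal ideal\<close>

locale residue_valuation = field_subring V for V :: "'a::field_char_0 set" +
  fixes p :: nat
  assumes valuation: "x \<in> V \<or> inverse x \<in> V"
    and prime: "prime p"
    and inverse_p: "inverse (of_nat p) \<notin> V"
begin

section \<open>The maximal ideal and congruences modulo it\<close>

text \<open>These are the non-units of \<open>V\<close>; zero is listed separately because
  \<open>inverse 0 = 0\<close> lies in \<open>V\<close>.\<close>

definition max_ideal :: "'a set" where
  "max_ideal = {x \<in> V. x = 0 \<or> inverse x \<notin> V}"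

lemma p_ge_2: "p \<ge> 2"
  using prime prime_ge_2_nat by blast

lemma p_nonzero: "(of_nat p :: 'a) \<noteq> 0"
  using p_ge_2 by simp

lemma zero_max_ideal [simp]: "0 \<in> max_ideal"
  unfolding max_ideal_def by simp

lemma one_not_max_ideal: "1 \<notin> max_ideal"
  unfolding max_ideal_def by simp

lemma p_max_ideal: "of_nat p \<in> max_ideal"
  unfolding max_ideal_def using inverse_p by simp

lemma max_ideal_mult:
  assumes "x \<in> V" "y \<in> max_ideal"
  shows "x * y \<in> max_ideal"
proof (cases "x * y = 0")
  case False
  have "inverse (x * y) \<notin> V"
  proof
    assume "inverse (x * y) \<in> V"
    then have "x * inverse (x * y) \<in> V"
      using assms by (intro mult_mem)
    moreover have "x * inverse (x * y) = inverse y"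
      using False by simp
    ultimately have "inverse y \<in> V"
      by metis
    then show False
      using assms False unfolding max_ideal_def by auto
  qed
  then show ?thesis
    using assms unfolding max_ideal_def by (auto intro: mult_mem)
qed auto

text \<open>One of the quotients \<open>x / y\<close> and \<open>y / x\<close> lies in
  \<open>V\<close>, so the sum is a multiple in \<open>V\<close> of one of the summands.\<close>

lemma max_ideal_add:
  assumes "x \<in> max_ideal" "y \<in> max_ideal"
  shows "x + y \<in> max_ideal"
proof -
  have *: "a + b \<in> max_ideal" if "a \<in> max_ideal" "b \<in> max_ideal" "b \<noteq> 0" "a / b \<in> V" for a b
  proof -
    have "(1 + a / b) * b \<in> max_ideal"
      using that by (intro max_ideal_mult add_mem) auto
    moreover have "(1 + a / b) * b = a + b"
      using that by (simp add: field_simps)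
    ultimately show ?thesis by simp
  qed
  consider "x = 0" | "y = 0" | "x \<noteq> 0" "y \<noteq> 0" "x / y \<in> V" | "x \<noteq> 0" "y \<noteq> 0" "y / x \<in> V"
    using valuation[of "x / y"] by (auto simp: inverse_eq_divide)
  then show ?thesis
    using *[of x y] *[of y x] assms by cases (auto simp: add.commute)
qed

lemma max_ideal_uminus: "x \<in> max_ideal \<Longrightarrow> - x \<in> max_ideal"
  using max_ideal_mult[of "-1" x] uminus_mem[OF one_mem] by simp

lemma max_ideal_diff: "x \<in> max_ideal \<Longrightarrow> y \<in> max_ideal \<Longrightarrow> x - y \<in> max_ideal"
  using max_ideal_add[of x "- y"] max_ideal_uminus by simp

lemma max_ideal_sum: "(\<And>i. i \<in> I \<Longrightarrow> f i \<in> max_ideal) \<Longrightarrow> (\<Sum>i\<in>I. f i) \<in> max_ideal"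
  by (induction I rule: infinite_finite_induct) (auto intro: max_ideal_add)

lemma max_ideal_powerD:
  assumes "x \<in> V" "x ^ n \<in> max_ideal"
  shows "x \<in> max_ideal"
proof (rule ccontr)
  assume "x \<notin> max_ideal"
  then have "x \<noteq> 0" "inverse x \<in> V"
    using assms unfolding max_ideal_def by auto
  then have "inverse x ^ n * x ^ n \<in> max_ideal"
    using assms by (intro max_ideal_mult power_mem)
  then show False
    using \<open>x \<noteq> 0\<close> one_not_max_ideal by (simp flip: power_mult_distrib)
qed

text \<open>An integer prime to \<open>p\<close> cannot lie in the ideal, since a Bezout relation
  with \<open>p\<close> would put \<open>1\<close> there. This turns the final membership into a
  divisibility of integers.\<close>

lemma of_int_max_ideal_iff: "(of_int n :: 'a) \<in> max_ideal \<longleftrightarrow> int p dvd n"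
proof
  assume "int p dvd n"
  then obtain k where "n = k * int p" by (metis dvdE mult.commute)
  then show "(of_int n :: 'a) \<in> max_ideal"
    using max_ideal_mult[OF of_int_mem[of k] p_max_ideal] by simp
next
  assume n: "(of_int n :: 'a) \<in> max_ideal"
  show "int p dvd n"
  proof (rule ccontr)
    assume "\<not> int p dvd n"
    then have "coprime (int p) n"
      using prime by (intro prime_imp_coprime) auto
    then obtain u v where "u * int p + v * n = 1"
      by (metis bezout_int coprime_imp_gcd_eq_1)
    then have "(of_int u * of_nat p + of_int v * of_int n :: 'a) = 1"
      by (metis of_int_1 of_int_add of_int_mult of_int_of_nat_eq)
    then show False
      using one_not_max_ideal max_ideal_add[OF max_ideal_mult[OF of_int_mem p_max_ideal]
          max_ideal_mult[OF of_int_mem n]] by metis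
  qed
qed

text \<open>The Frobenius argument: with \<open>y = z - 1\<close>, the inner binomial coefficients
  are divisible by \<open>p\<close>, so \<open>y ^ p\<close> is congruent to
  \<open>z ^ p - 1\<close>.\<close>

lemma prime_power_cong_one:
  assumes z: "z \<in> V" and cong: "z ^ p - 1 \<in> max_ideal"
  shows "z - 1 \<in> max_ideal"
proof -
  define y where "y = z - 1"
  have y: "y \<in> V"
    using z unfolding y_def by (intro diff_mem) auto
  have "z ^ p = (\<Sum>k\<le>p. of_nat (p choose k) * y ^ k)"
    using binomial_ring[of y 1 p] unfolding y_def by simp
  also have "{..p} = {0, p} \<union> {1..<p}"
    using p_ge_2 by auto
  also have "(\<Sum>k\<in>{0, p} \<union> {1..<p}. of_nat (p choose k) * y ^ k)
      = 1 + y ^ p + (\<Sum>k\<in>{1..<p}. of_nat (p choose k) * y ^ k)"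
    using p_ge_2 by (subst sum.union_disjoint) auto
  finally have "y ^ p = (z ^ p - 1) - (\<Sum>k\<in>{1..<p}. y ^ k * of_int (int (p choose k)))"
    by (simp add: mult.commute)
  also have "\<dots> \<in> max_ideal"
    using y prime
    by (intro max_ideal_diff cong max_ideal_sum max_ideal_mult power_mem)
       (auto simp: of_int_max_ideal_iff intro!: dvd_choose_prime simp del: of_int_of_nat_eq)
  finally show ?thesis
    using max_ideal_powerD[OF y] unfolding y_def by simp
qed

lemma power_cong_one:
  assumes "z \<in> V" "z - 1 \<in> max_ideal"
  shows "z ^ n - 1 \<in> max_ideal"
proof -
  have "z ^ n - 1 = (\<Sum>i<n. z ^ i) * (z - 1)"
    by (simp add: power_diff_1_eq mult.commute)
  then show ?thesis
    using assms by (auto intro!: max_ideal_mult sum_mem power_mem)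
qed

text \<open>\<open>hasse a i z\<close> is the value at \<open>z\<close> of \<open>f^(i) / i!\<close>, where \<open>f = \<Sum>j\<le>p+1. a j * X^j\<close>;
  terms with \<open>j < i\<close> vanish because the binomial coefficient does.\<close>

definition hasse :: "(nat \<Rightarrow> 'a) \<Rightarrow> nat \<Rightarrow> 'a \<Rightarrow> 'a" where
  "hasse a i z = (\<Sum>j\<le>p + 1. of_nat (j choose i) * a j * z ^ (j - i))"

lemma hasse_at_0:
  assumes "i \<le> p + 1"
  shows "hasse a i 0 = a i"
proof -
  have "hasse a i 0 = (\<Sum>j\<in>{i}. of_nat (j choose i) * a j * 0 ^ (j - i))"
    unfolding hasse_def
    by (rule sum.mono_neutral_right) (use assms in \<open>auto simp: binomial_eq_0 power_0_left\<close>)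
  then show ?thesis by simp
qed

text \<open>The normalised situation: \<open>a p = 0\<close> puts the center of mass at
  \<open>0\<close>, \<open>a 0 = 0\<close> makes it a root, and scaling has made \<open>1\<close> a
  root and brought the common roots into \<open>V\<close>.\<close>

context
  fixes a :: "nat \<Rightarrow> 'a"
  assumes monic: "a (p + 1) = 1" and a_p: "a p = 0" and a_0: "a 0 = 0"
    and root_one: "hasse a 0 1 = 0"
    and common_root: "\<And>i. i \<in> {1..p-1} \<Longrightarrow> \<exists>z\<in>V. hasse a 0 z = 0 \<and> hasse a i z = 0"
begin

lemma hasse_expand:
  "hasse a i z = of_nat (1 choose i) * a 1 * z ^ (1 - i)
    + (\<Sum>j=2..p-1. of_nat (j choose i) * a j * z ^ (j - i))
    + of_nat ((p + 1) choose i) * z ^ (p + 1 - i)"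
  unfolding hasse_def sum_atMost_prime_succ[OF p_ge_2] by (simp only: monic a_p a_0) simp

lemma prime_dvd_choose_succ:
  assumes "i \<in> {2..p-1}"
  shows "p dvd (p + 1) choose i"
proof -
  obtain k where k: "i = Suc k" "k > 0"
    using assms by (cases i) auto
  have "p dvd p choose k" "p dvd p choose i"
    using assms k prime by (auto intro!: dvd_choose_prime)
  then show ?thesis
    using k by simp
qed

lemma coeff_divisible:
  assumes "i \<in> {2..p-1}"
  shows "a i / of_nat p \<in> V"
  using assms
\<comment> \<open>Downward induction on \<open>i\<close>: in \<open>hasse a i z = 0\<close> the
  coefficient \<open>a i\<close> stands alone, and all other surviving terms have larger index or
  carry the factor \<open>p * c\<close>.\<close>
proof (induction "p - i" arbitrary: i rule: less_induct)
  case less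
  obtain z where z: "z \<in> V" "hasse a i z = 0"
    using common_root[of i] less.prems by auto
  obtain c where c: "(p + 1) choose i = p * c"
    using prime_dvd_choose_succ[OF less.prems] by (elim dvdE)
  have "(\<Sum>j=2..p-1. of_nat (j choose i) * a j * z ^ (j - i))
      = (\<Sum>j\<in>{i..p-1}. of_nat (j choose i) * a j * z ^ (j - i))"
    by (rule sum.mono_neutral_right) (use less.prems in \<open>auto simp: binomial_eq_0\<close>)
  also have "\<dots> = a i + (\<Sum>j\<in>{i<..p-1}. of_nat (j choose i) * a j * z ^ (j - i))"
    using less.prems by (subst sum.head) auto
  finally have "a i + ((\<Sum>j\<in>{i<..p-1}. of_nat (j choose i) * a j * z ^ (j - i))
      + of_nat p * of_nat c * z ^ (p + 1 - i)) = 0"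
    using z(2) less.prems unfolding hasse_expand c
    by (simp add: binomial_eq_0 add.assoc)
  then have "a i = - ((\<Sum>j\<in>{i<..p-1}. of_nat (j choose i) * a j * z ^ (j - i))
      + of_nat p * of_nat c * z ^ (p + 1 - i))"
    by (simp only: eq_neg_iff_add_eq_0)
  then have "a i / of_nat p = - ((\<Sum>j\<in>{i<..p-1}. of_nat (j choose i) * (a j / of_nat p) * z ^ (j - i))
      + of_nat c * z ^ (p + 1 - i))"
    using p_nonzero by (simp add: field_simps sum_distrib_left sum_divide_distrib)
  also have "\<dots> \<in> V"
    using less z by (intro uminus_mem add_mem sum_mem mult_mem power_mem) auto
  finally show ?case .
qed

section \<open>Congruences after division by \<open>p\<close>\<close>

definition \<alpha> :: "nat \<Rightarrow> 'a" where
  "\<alpha> j = a j / of_nat p"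

lemma alpha_mem: "j \<in> {2..p-1} \<Longrightarrow> \<alpha> j \<in> V"
  unfolding \<alpha>_def by (rule coeff_divisible)

lemma sum_alpha:
  "(\<Sum>j=2..p-1. of_nat (j choose i) * a j * z ^ (j - i))
    = of_nat p * (\<Sum>j=2..p-1. of_nat (j choose i) * \<alpha> j * z ^ (j - i))"
  unfolding \<alpha>_def sum_distrib_left using p_nonzero by (intro sum.cong) auto

lemma a_1: "a 1 = - 1 - of_nat p * (\<Sum>j=2..p-1. \<alpha> j)"
  using root_one unfolding hasse_expand sum_alpha by (simp add: algebra_simps eq_neg_iff_add_eq_0)

text \<open>Dividing the equation by \<open>z\<close> and inserting \<open>a_1\<close> makes
  \<open>z ^ p - 1\<close> a multiple of \<open>p\<close> in \<open>V\<close>;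
  \<open>prime_power_cong_one\<close> finishes.\<close>

lemma root_cong_one:
  assumes z: "z \<in> V" "z \<noteq> 0" "hasse a 0 z = 0"
  shows "z - 1 \<in> max_ideal"
proof (rule prime_power_cong_one[OF z(1)])
  have "a 1 * z + of_nat p * (\<Sum>j=2..p-1. \<alpha> j * z ^ j) + z ^ p * z = 0"
    using z(3) unfolding hasse_expand sum_alpha by (simp add: mult.commute)
  also have "(\<Sum>j=2..p-1. \<alpha> j * z ^ j) = (\<Sum>j=2..p-1. \<alpha> j * z ^ (j - 1)) * z"
    unfolding sum_distrib_right
    by (rule sum.cong) (auto simp: mult.assoc simp flip: power_Suc2)
  finally have "(a 1 + of_nat p * (\<Sum>j=2..p-1. \<alpha> j * z ^ (j - 1)) + z ^ p) * z = 0"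
    by (simp add: algebra_simps)
  then have "a 1 + of_nat p * (\<Sum>j=2..p-1. \<alpha> j * z ^ (j - 1)) + z ^ p = 0"
    using z(2) by (metis mult_eq_0_iff)
  then have "z ^ p - 1 = ((\<Sum>j=2..p-1. \<alpha> j) - (\<Sum>j=2..p-1. \<alpha> j * z ^ (j - 1))) * of_nat p"
    unfolding a_1 by (simp add: algebra_simps)
  also have "\<dots> \<in> max_ideal"
    using z(1) by (intro max_ideal_mult p_max_ideal diff_mem sum_mem mult_mem power_mem alpha_mem) auto
  finally show "z ^ p - 1 \<in> max_ideal" .
qed

text \<open>\<open>B i\<close> is the \<open>i\<close>-th Taylor coefficient at \<open>1\<close> of
  the middle part, the sum of the terms \<open>\<alpha> j * X^j\<close>.\<close>

definition B :: "nat \<Rightarrow> 'a" where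
  "B i = (\<Sum>j=2..p-1. of_nat (j choose i) * \<alpha> j)"

text \<open>Every power of \<open>z\<close> is congruent to \<open>1\<close>. The exponents
  \<open>e\<close> are left free because both \<open>j - i\<close> and \<open>j\<close> occur
  below.\<close>

lemma sum_alpha_cong_B:
  assumes "z \<in> V" "z - 1 \<in> max_ideal"
  shows "(\<Sum>j=2..p-1. of_nat (j choose i) * \<alpha> j * z ^ (e j)) - B i \<in> max_ideal"
proof -
  have "(\<Sum>j=2..p-1. of_nat (j choose i) * \<alpha> j * z ^ (e j)) - B i
      = (\<Sum>j=2..p-1. (of_nat (j choose i) * \<alpha> j) * (z ^ (e j) - 1))"
    unfolding B_def by (simp add: algebra_simps flip: sum_subtractf)
  also have "\<dots> \<in> max_ideal"
    using assms by (intro max_ideal_sum max_ideal_mult power_cong_one mult_mem alpha_mem) auto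
  finally show ?thesis .
qed

lemma B_cong:
  assumes i: "i \<in> {2..p-1}" "a i \<noteq> 0" and c: "(p + 1) choose i = p * c"
  shows "B i + of_nat c \<in> max_ideal"
proof -
  obtain z where z: "z \<in> V" "hasse a 0 z = 0" "hasse a i z = 0"
    using common_root[of i] i by auto
  \<comment> \<open>At \<open>0\<close> the value of \<open>hasse a i\<close> is \<open>a i\<close>,
    which is nonzero.\<close>
  have "z \<noteq> 0"
    using z i hasse_at_0[of i a] by auto
  then have z1: "z - 1 \<in> max_ideal"
    using root_cong_one z by blast
  have "of_nat p * ((\<Sum>j=2..p-1. of_nat (j choose i) * \<alpha> j * z ^ (j - i)) + of_nat c * z ^ (p + 1 - i)) = 0"
    using z(3) i unfolding hasse_expand sum_alpha c
    by (simp add: binomial_eq_0 algebra_simps)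
  then have "(\<Sum>j=2..p-1. of_nat (j choose i) * \<alpha> j * z ^ (j - i)) + of_nat c * z ^ (p + 1 - i) = 0"
    using p_nonzero by (metis mult_eq_0_iff)
  then have "B i + of_nat c
      = - ((\<Sum>j=2..p-1. of_nat (j choose i) * \<alpha> j * z ^ (j - i)) - B i)
        - of_nat c * (z ^ (p + 1 - i) - 1)"
    by (simp add: algebra_simps)
  also have "\<dots> \<in> max_ideal"
    by (rule max_ideal_diff[OF max_ideal_uminus[OF sum_alpha_cong_B] max_ideal_mult[OF _ power_cong_one]])
       (use z(1) z1 in auto)
  finally show ?thesis .
qed

text \<open>All coefficients of \<open>X f' - f\<close> are divisible by \<open>p\<close>, so its vanishing at a common root of \<open>f\<close>
  and \<open>f'\<close> can be divided by \<open>p\<close> before reducing.\<close>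

lemma B_0_1_cong: "1 + B 1 - B 0 \<in> max_ideal"
proof -
  have one_in: "1 \<in> {1..p-1}"
    using p_ge_2 by auto
  obtain z where z: "z \<in> V" "hasse a 0 z = 0" "hasse a 1 z = 0"
    using common_root[of 1] one_in by blast
  define S where "S i = (\<Sum>j=2..p-1. of_nat (j choose i) * \<alpha> j * z ^ j)" for i
  have h0: "a 1 * z + of_nat p * S 0 + z ^ (p + 1) = 0"
    using z(2) unfolding hasse_expand sum_alpha S_def by simp
  have h1: "a 1 + of_nat p * (\<Sum>j=2..p-1. of_nat (j choose 1) * \<alpha> j * z ^ (j - 1)) + (of_nat p + 1) * z ^ p = 0"
    using z(3) unfolding hasse_expand sum_alpha by (simp add: algebra_simps)
  \<comment> \<open>At \<open>z = 0\<close> the derivative condition would make \<open>a 1\<close> a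
    multiple of \<open>p\<close>, whereas \<open>a_1\<close> makes it congruent to
    \<open>-1\<close>.\<close>
  have "z \<noteq> 0"
  proof
    assume "z = 0"
    then have "a 1 = - (of_nat p * (\<Sum>j=2..p-1. of_nat (j choose 1) * \<alpha> j * z ^ (j - 1)))"
      using h1 p_ge_2 by (simp add: eq_neg_iff_add_eq_0 power_0_left)
    then have "1 = ((\<Sum>j=2..p-1. of_nat (j choose 1) * \<alpha> j * z ^ (j - 1)) - (\<Sum>j=2..p-1. \<alpha> j)) * of_nat p"
      unfolding a_1 by (simp add: algebra_simps)
    also have "\<dots> \<in> max_ideal"
      using z(1) by (intro max_ideal_mult p_max_ideal diff_mem sum_mem mult_mem power_mem alpha_mem) auto
    finally show False
      using one_not_max_ideal by simp
  qed
  then have z1: "z - 1 \<in> max_ideal"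
    using root_cong_one z by blast
  have "S 1 = (\<Sum>j=2..p-1. of_nat (j choose 1) * \<alpha> j * z ^ (j - 1)) * z"
    unfolding S_def sum_distrib_right
    by (rule sum.cong) (auto simp: mult.assoc simp flip: power_Suc2)
  then have "a 1 * z + of_nat p * S 1 + (of_nat p + 1) * z ^ (p + 1)
      = (a 1 + of_nat p * (\<Sum>j=2..p-1. of_nat (j choose 1) * \<alpha> j * z ^ (j - 1)) + (of_nat p + 1) * z ^ p) * z"
    by (simp add: algebra_simps)
  then have "a 1 * z + of_nat p * S 1 + (of_nat p + 1) * z ^ (p + 1) = 0"
    unfolding h1 by simp
  \<comment> \<open>Here \<open>a 1\<close> cancels and the leading coefficient drops from
    \<open>p + 1\<close> to \<open>p\<close>.\<close>
  moreover have "of_nat p * (S 1 - S 0 + z ^ (p + 1))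
      = (a 1 * z + of_nat p * S 1 + (of_nat p + 1) * z ^ (p + 1)) - (a 1 * z + of_nat p * S 0 + z ^ (p + 1))"
    by (simp add: algebra_simps)
  ultimately have "of_nat p * (S 1 - S 0 + z ^ (p + 1)) = 0"
    unfolding h0 by simp
  then have "S 1 - S 0 + z ^ (p + 1) = 0"
    using p_nonzero by simp
  then have "1 + B 1 - B 0 = (S 0 - B 0) - (S 1 - B 1) - (z ^ (p + 1) - 1)"
    by (simp add: algebra_simps)
  also have "\<dots> \<in> max_ideal"
    unfolding S_def
    by (rule max_ideal_diff[OF max_ideal_diff[OF sum_alpha_cong_B sum_alpha_cong_B] power_cong_one])
       (use z(1) z1 in auto)
  finally show ?thesis .
qed

text \<open>After exchanging the sums, each \<open>\<alpha> j\<close> is multiplied by the weighted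
  sum of row \<open>j\<close>. This is zero for \<open>j \<noteq> l\<close>, and for
  \<open>j = l\<close> the factor \<open>\<alpha> l\<close> is zero.\<close>

lemma sum_wt_B:
  assumes "a l = 0"
  shows "(\<Sum>i\<le>p + 1. of_int (wt l i) * B i) = 0"
proof -
  have "(\<Sum>i\<le>p + 1. of_int (wt l i) * B i)
      = (\<Sum>i\<le>p + 1. \<Sum>j=2..p-1. of_int (wt l i * int (j choose i)) * \<alpha> j)"
    unfolding B_def by (simp add: sum_distrib_left mult.assoc)
  also have "\<dots> = (\<Sum>j=2..p-1. \<alpha> j * of_int (\<Sum>i\<le>p + 1. wt l i * int (j choose i)))"
    by (subst sum.swap) (simp only: of_int_sum sum_distrib_left mult.commute)
  also have "\<dots> = 0"
  proof (rule sum.neutral, rule ballI)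
    fix j assume j: "j \<in> {2..p-1}"
    show "\<alpha> j * of_int (\<Sum>i\<le>p + 1. wt l i * int (j choose i)) = 0"
    proof (cases "j = l")
      case True
      then show ?thesis using assms unfolding \<alpha>_def by simp
    next
      case False
      then show ?thesis using j by (subst sum_wt_choose) auto
    qed
  qed
  finally show ?thesis .
qed

text \<open>Inserting the congruences for \<open>B\<close> into \<open>sum_wt_B\<close> puts the
  integer of \<open>wt_combination_not_dvd\<close> into the maximal ideal. The choice
  \<open>l = p\<close> covers the case in which no coefficient in \<open>{2..p-1}\<close>
  vanishes.\<close>

lemma not_single_vanishing:
  assumes l: "2 \<le> l" "l \<le> p" "a l = 0" and nonzero: "\<And>i. i \<in> {2..p-1} \<Longrightarrow> i \<noteq> l \<Longrightarrow> a i \<noteq> 0"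
  shows False
proof -
  define c where "c i = ((p + 1) choose i) div p" for i
  have c: "(p + 1) choose i = p * c i" if "i \<in> {2..p-1}" for i
    using prime_dvd_choose_succ[OF that] unfolding c_def by simp
  have B_zero: "B p = 0" "B (p + 1) = 0"
    unfolding B_def using p_ge_2 by (auto intro!: sum.neutral simp: binomial_eq_0)
  have "wt l 0 = 1" "wt l 1 = - 1"
    unfolding wt_def using l by (auto simp: binomial_eq_0)
  then have "B 0 - B 1 + (\<Sum>i=2..p-1. of_int (wt l i) * B i) = 0"
    using sum_wt_B[OF l(3)] l unfolding sum_atMost_prime_succ[OF p_ge_2] B_zero
    by simp
  then have "of_int (1 - (\<Sum>i=2..p-1. wt l i * int (c i)))
      = (1 + B 1 - B 0) - (\<Sum>i=2..p-1. of_int (wt l i) * (B i + of_nat (c i)))"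
    by (simp add: algebra_simps sum.distrib)
  also have "\<dots> \<in> max_ideal"
  proof (rule max_ideal_diff[OF B_0_1_cong max_ideal_sum])
    fix i assume i: "i \<in> {2..p-1}"
    show "of_int (wt l i) * (B i + of_nat (c i)) \<in> max_ideal"
    proof (cases "i = l")
      \<comment> \<open>The weight at \<open>l\<close> is zero, so the missing congruence does not
        enter.\<close>
      case True
      then show ?thesis by (simp add: wt_def)
    next
      case False
      then show ?thesis
        using i nonzero c by (intro max_ideal_mult B_cong) auto
    qed
  qed
  finally show False
    using wt_combination_not_dvd[OF prime l(1,2) c] unfolding of_int_max_ideal_iff by blast
qed

end

end

section \<open>Casas-Alvero polynomials\<close>

text \<open>The coefficient of \<open>X^n\<close> picks up a rising factorial, which is
  \<open>fact i\<close> times a binomial coefficient. Summing over all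
  \<open>j \<le> degree f\<close> matches the form of \<open>hasse\<close>.\<close>

lemma poly_higher_pderiv:
  fixes f :: "'a::{idom,semiring_char_0} poly"
  shows "poly ((pderiv ^^ i) f) z
    = fact i * (\<Sum>j\<le>degree f. of_nat (j choose i) * coeff f j * z ^ (j - i))"
proof -
  have term_eq: "coeff ((pderiv ^^ i) f) n = fact i * (of_nat ((n + i) choose i) * coeff f (n + i))" for n
  proof -
    have "(pochhammer (of_nat (Suc n)) i :: 'a) = of_nat (pochhammer (Suc n) i)"
      by (rule pochhammer_of_nat)
    also have "pochhammer (Suc n) i = fact i * ((n + i) choose i)"
    proof -
      have "fact n * pochhammer (Suc n) i = (fact (n + i) :: nat)"
        using pochhammer_product'[of "1 :: nat" n i] by (simp add: pochhammer_fact)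
      also have "\<dots> = fact n * (fact i * ((n + i) choose i))"
        using binomial_fact_lemma[of i "n + i"] by (simp add: mult_ac del: fact_Suc)
      finally show ?thesis by simp
    qed
    finally show ?thesis
      by (simp add: coeff_higher_pderiv mult_ac)
  qed
  have "degree ((pderiv ^^ i) f) \<le> degree f"
    by (rule degree_le) (auto simp: term_eq coeff_eq_0)
  then have "poly ((pderiv ^^ i) f) z = (\<Sum>n\<le>degree f. coeff ((pderiv ^^ i) f) n * z ^ n)"
    unfolding poly_altdef by (intro sum.mono_neutral_left) (auto simp: coeff_eq_0)
  also have "\<dots> = (\<Sum>n\<in>{n. n + i \<le> degree f}. coeff ((pderiv ^^ i) f) n * z ^ n)"
    by (rule sum.mono_neutral_right) (auto simp: term_eq coeff_eq_0)
  also have "\<dots> = (\<Sum>j\<in>{i..degree f}. fact i * (of_nat (j choose i) * coeff f j * z ^ (j - i)))"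
    by (rule sum.reindex_bij_witness[of _ "\<lambda>j. j - i" "\<lambda>n. n + i"])
       (auto simp: term_eq mult.assoc)
  also have "\<dots> = (\<Sum>j\<le>degree f. fact i * (of_nat (j choose i) * coeff f j * z ^ (j - i)))"
    by (rule sum.mono_neutral_left) (auto simp: binomial_eq_0)
  finally show ?thesis
    by (simp add: sum_distrib_left)
qed

lemma higher_pderiv_pcompose_linear:
  "(pderiv ^^ i) (pcompose f [:c, s:]) = smult (s ^ i) (pcompose ((pderiv ^^ i) f) [:c, s:])"
proof (induction i)
  case (Suc i)
  have "pderiv [:c, s:] = [:s:]"
    by (simp add: pderiv_pCons)
  then show ?case
    using Suc by (simp add: pderiv_smult pderiv_pcompose mult.commute)
qed simp

section \<open>The center of mass as the root of the last derivative\<close>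

text \<open>Vieta's formula for the second highest coefficient. The shift by \<open>pCons 0\<close>
  avoids the index \<open>size M - 1\<close> and makes the formula hold for the empty multiset; the
  first two claims feed the induction.\<close>

lemma coeff_prod_mset_linear:
  fixes M :: "'a::comm_ring_1 multiset"
  shows "degree (\<Prod>z\<in>#M. [:-z, 1:]) \<le> size M"
    and "coeff (\<Prod>z\<in>#M. [:-z, 1:]) (size M) = 1"
    and "coeff (pCons 0 (\<Prod>z\<in>#M. [:-z, 1:])) (size M) = - (\<Sum>z\<in>#M. z)"
proof (induction M)
  case (add x M)
  define P where "P = (\<Prod>z\<in>#M. [:-z, 1:])"
  have eq: "(\<Prod>z\<in>#add_mset x M. [:-z, 1:]) = pCons 0 P - smult x P"
    unfolding P_def by simp
  note IH = add[folded P_def]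
  have "degree (pCons 0 P) \<le> Suc (size M)" "degree (smult x P) \<le> Suc (size M)"
    using IH(1) degree_pCons_le[of 0 P] degree_smult_le[of x P] by linarith+
  then show "degree (\<Prod>z\<in>#add_mset x M. [:-z, 1:]) \<le> size (add_mset x M)"
    unfolding eq by (auto intro: degree_diff_le)
  show "coeff (\<Prod>z\<in>#add_mset x M. [:-z, 1:]) (size (add_mset x M)) = 1"
    unfolding eq using IH by (simp add: coeff_eq_0)
  show "coeff (pCons 0 (\<Prod>z\<in>#add_mset x M. [:-z, 1:])) (size (add_mset x M))
      = - (\<Sum>z\<in>#add_mset x M. z)"
    unfolding eq using IH by simp
qed auto

text \<open>Only the two highest coefficients survive in this derivative, and Vieta's formula
  expresses their ratio by the sum of the roots.\<close>

lemma last_pderiv_root_iff: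
  assumes "degree f = Suc m"
  shows "poly ((pderiv ^^ m) f) z = 0 \<longleftrightarrow> z = center_of_mass f"
proof -
  have f0: "f \<noteq> 0" using assms by auto
  then have size: "size (proots f) = Suc m"
    using assms by (simp add: size_proots_complex)
  define P where "P = (\<Prod>z\<in>#proots f. [:-z, 1:])"
  have f: "f = smult (lead_coeff f) P"
    unfolding P_def by (rule complex_poly_decompose_multiset[symmetric])
  have "coeff P m = - (\<Sum>z\<in>#proots f. z)"
    using coeff_prod_mset_linear(3)[of "proots f"] size unfolding P_def by simp
  then have vieta: "coeff f m = - lead_coeff f * (\<Sum>z\<in>#proots f. z)"
    using arg_cong[OF f, of "\<lambda>q. coeff q m"] by simp
  have "(\<Sum>j\<le>Suc m. of_nat (j choose m) * coeff f j * z ^ (j - m))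
      = (\<Sum>j\<in>{m, Suc m}. of_nat (j choose m) * coeff f j * z ^ (j - m))"
    by (rule sum.mono_neutral_right) (auto simp: binomial_eq_0)
  also have "\<dots> = lead_coeff f * (of_nat (Suc m) * z - (\<Sum>z\<in>#proots f. z))"
    using assms vieta by (simp add: algebra_simps)
  finally have "poly ((pderiv ^^ m) f) z
      = fact m * (lead_coeff f * (of_nat (Suc m) * z - (\<Sum>z\<in>#proots f. z)))"
    unfolding poly_higher_pderiv assms by simp
  then have "poly ((pderiv ^^ m) f) z = 0 \<longleftrightarrow> of_nat (Suc m) * z = (\<Sum>z\<in>#proots f. z)"
    using f0 by simp
  moreover have "of_nat (Suc m) \<noteq> (0 :: complex)"
    by (rule of_nat_neq_0)
  ultimately show ?thesis
    unfolding center_of_mass_def assms by (simp add: field_simps del: of_nat_Suc)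
qed

text \<open>Of two nonzero elements one divides the other in \<open>V\<close>, so a finite set has
  an element dividing all others. It serves as the scaling factor for the roots.\<close>

lemma valuation_max_exists:
  assumes "valuation_ring V" "finite R" "R \<noteq> {}" "0 \<notin> R"
  shows "\<exists>s\<in>R. \<forall>r\<in>R. r / s \<in> V"
  using assms(2-4)
proof (induction R rule: finite_ne_induct)
  case (singleton x)
  then show ?case
    using assms(1) by (auto simp: valuation_ring_def subring_of_field_def)
next
  case (insert x R)
  interpret field_subring V
    using assms(1) by unfold_locales (simp add: valuation_ring_def)
  obtain s where s: "s \<in> R" "\<And>r. r \<in> R \<Longrightarrow> r / s \<in> V"
    using insert by auto
  have nz: "s \<noteq> 0" "x \<noteq> 0" using s insert by auto
  consider "x / s \<in> V" | "s / x \<in> V"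
    using assms(1) unfolding valuation_ring_def by (metis inverse_divide)
  then show ?case
  proof cases
    case 1
    then show ?thesis using s by auto
  next
    case 2
    have "r / x \<in> V" if "r \<in> R" for r
      using mult_mem[OF s(2)[OF that] 2] nz by simp
    then show ?thesis using nz by auto
  qed
qed

theorem proposition7:
  fixes p N :: nat and f :: "complex poly" and c :: complex
  assumes "prime p"
    and "N = p + 1"
    and "degree f = N"
    and "CA_polynomial f"
    and "nontrivial_poly f"
    and "c = center_of_mass f"
  shows "\<exists>l1 l2. 2 \<le> l1 \<and> l1 < l2 \<and> l2 \<le> N - 2 \<and>
           poly ((pderiv ^^ l1) f) c = 0 \<and> poly ((pderiv ^^ l2) f) c = 0"
proof (rule ccontr)
  assume neg: "\<not> ?thesis"
  have p2: "p \<ge> 2" using assms(1) prime_ge_2_nat by blast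
  have f0: "f \<noteq> 0" using assms by auto
  have CA: "\<exists>z. poly f z = 0 \<and> poly ((pderiv ^^ i) f) z = 0" if "i \<in> {1..p}" for i
    using assms(2-4) that unfolding CA_polynomial_def by auto
  \<comment> \<open>The only root of the \<open>p\<close>-th derivative is \<open>c\<close>, so the
    common root for \<open>i = p\<close> forces \<open>c\<close> to be a root of
    \<open>f\<close>.\<close>
  have c_p: "poly ((pderiv ^^ p) f) c = 0" and f_c: "poly f c = 0"
    using CA[of p] last_pderiv_root_iff[of f p] assms p2 by auto
  define R where "R = (\<lambda>z. z - c) ` ({z. poly f z = 0} - {c})"
  have R_ne: "R \<noteq> {}"
    using assms(5) unfolding R_def nontrivial_poly_def by blast
  have R_fin: "finite R" and R_0: "0 \<notin> R"
    unfolding R_def using f0 by (auto simp: poly_roots_finite)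
  have "\<exists>V::complex set. valuation_ring V \<and> \<int> \<subseteq> V \<and> inverse (of_nat p) \<notin> V"
  proof (rule valuation_ring_exists)
    show "subring_of_field (\<int> :: complex set)"
      by (simp add: subring_of_field_def)
    show "inverse (of_nat p) \<notin> (\<int> :: complex set)"
    proof
      assume "inverse (of_nat p) \<in> (\<int> :: complex set)"
      then obtain k where "inverse (of_nat p) = (of_int k :: complex)"
        by (elim Ints_cases)
      then have "of_int (k * int p) = (1 :: complex)"
        using p2 by (simp add: field_simps)
      then have "k * int p = 1"
        using of_int_eq_1_iff by blast
      then show False
        using p2 by (auto simp: zmult_eq_1_iff)
    qed
  qed simp
  then obtain V :: "complex set" where V: "valuation_ring V" "inverse (of_nat p) \<notin> V"
    by blast
  obtain s where s: "s \<in> R" "\<And>r. r \<in> R \<Longrightarrow> r / s \<in> V"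
    using valuation_max_exists[OF V(1) R_fin R_ne R_0] by blast
  have s0: "s \<noteq> 0" and f_s: "poly f (c + s) = 0"
    using s(1) unfolding R_def by auto
  interpret residue_valuation V p
    by unfold_locales (use V assms(1) in \<open>auto simp: valuation_ring_def\<close>)
  \<comment> \<open>The substitution moves \<open>c\<close> to \<open>0\<close> and the root
    \<open>c + s\<close> to \<open>1\<close>; below, \<open>a\<close> lists the coefficients of
    \<open>g\<close> made monic.\<close>
  define g where "g = pcompose f [:c, s:]"
  have deg_g: "degree g = p + 1"
    unfolding g_def using assms s0 by (simp add: degree_pcompose)
  then have "g \<noteq> 0" by auto
  define k where "k = lead_coeff g"
  have k: "k \<noteq> 0"
    unfolding k_def using \<open>g \<noteq> 0\<close> by (rule leading_coeff_neq_0)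
  define a where "a j = coeff g j / k" for j
  have hasse_0_iff: "hasse a i z = 0 \<longleftrightarrow> poly ((pderiv ^^ i) f) (c + s * z) = 0" for i z
  proof -
    have "poly ((pderiv ^^ i) g) z = s ^ i * poly ((pderiv ^^ i) f) (c + s * z)"
      unfolding g_def higher_pderiv_pcompose_linear by (simp add: poly_pcompose mult.commute)
    then have 1: "poly ((pderiv ^^ i) g) z = 0 \<longleftrightarrow> poly ((pderiv ^^ i) f) (c + s * z) = 0"
      using s0 by simp
    have "coeff g j = k * a j" for j
      unfolding a_def using k by simp
    then have "poly ((pderiv ^^ i) g) z = fact i * (k * hasse a i z)"
      unfolding poly_higher_pderiv hasse_def deg_g sum_distrib_left by (simp only: mult_ac)
    then have "poly ((pderiv ^^ i) g) z = 0 \<longleftrightarrow> hasse a i z = 0"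
      using k by simp
    with 1 show ?thesis
      by simp
  qed
  have a_iff: "a i = 0 \<longleftrightarrow> poly ((pderiv ^^ i) f) c = 0" if "i \<le> p + 1" for i
    using hasse_0_iff[of i 0] hasse_at_0[OF that] by simp
  \<comment> \<open>By \<open>neg\<close> at most one coefficient in \<open>{2..p-1}\<close>
    vanishes; if none does, \<open>a p = 0\<close> supplies \<open>l = p\<close>.\<close>
  have "\<exists>l\<in>{2..p}. a l = 0 \<and> (\<forall>i\<in>{2..p-1}. i \<noteq> l \<longrightarrow> a i \<noteq> 0)"
  proof (cases "\<exists>l\<in>{2..p-1}. a l = 0")
    case True
    then obtain l where l: "l \<in> {2..p-1}" "a l = 0" by blast
    have "a i \<noteq> 0" if "i \<in> {2..p-1}" "i \<noteq> l" for i
    proof -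
      have "i \<le> p + 1" "l \<le> p + 1"
        using l that by auto
      then show ?thesis
        using neg l that assms(2) a_iff[of i] a_iff[of l]
        by (cases i l rule: linorder_cases) auto
    qed
    then show ?thesis using l by auto
  next
    case False
    then show ?thesis
      using p2 c_p a_iff[of p] by (intro bexI[of _ p]) auto
  qed
  then obtain l where l: "2 \<le> l" "l \<le> p" "a l = 0" "\<And>i. i \<in> {2..p-1} \<Longrightarrow> i \<noteq> l \<Longrightarrow> a i \<noteq> 0"
    by auto
  show False
  proof (rule not_single_vanishing[where a = a and l = l, OF _ _ _ _ _ l])
    show "a (p + 1) = 1"
      unfolding a_def using k unfolding k_def deg_g by (rule divide_self)
    show "a p = 0" "a 0 = 0"
      using a_iff c_p f_c by auto
    show "hasse a 0 1 = 0"
      using f_s by (simp add: hasse_0_iff)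
  next
    fix i assume "i \<in> {1..p-1}"
    then have "i \<in> {1..p}"
      by auto
    then obtain w where w: "poly f w = 0" "poly ((pderiv ^^ i) f) w = 0"
      using CA by blast
    \<comment> \<open>The root \<open>w = c\<close> is not represented in \<open>R\<close>, but its
      rescaled value is \<open>0\<close>.\<close>
    have "(w - c) / s \<in> V"
      using s(2)[of "w - c"] w(1) by (cases "w = c") (auto simp: R_def)
    moreover have "c + s * ((w - c) / s) = w"
      using s0 by simp
    ultimately show "\<exists>z\<in>V. hasse a 0 z = 0 \<and> hasse a i z = 0"
      using w by (intro bexI[of _ "(w - c) / s"]) (auto simp: hasse_0_iff)
  qed
qed

end
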